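(* Let $a,b$ be positive integers and suppose that the improper integral $\int_0^{+\infty}\frac{\sin^b x}{x^{a+1}}\,dx$ converges. Then $$\int_0^{+\infty}\frac{\sin^b x}{x^{a+1}}\,dx=\frac{\left|\sum_{k=1}^{b}k^a\,t_k\,C_b^{\frac{b-k}{2}}\,d_k\right|}{2^{b-1}\,\Gamma(a+1)},$$ where, for $1\le k\le b$, $$t_k=\frac{\left[1+(-1)^{b-k}\right](-1)^{\lfloor k/2\rfloor}}{2},\qquad d_k=\begin{vmatrix}\frac{\pi}{2}&\ln k\\ \cos\frac{(a+b)\pi}{2}&\sin\frac{(a+b)\pi}{2}\end{vmatrix}=\frac{\pi}{2}\sin\frac{(a+b)\pi}{2}-\ln k\,\cos\frac{(a+b)\pi}{2}.$$
   Context: $\Gamma$ is the Gamma function and $C_n^m=\binom{n}{m}$ is the binomial coefficient. When $b-k$ is odd, $t_k=0$ and the corresponding term of the sum is taken to be $0$, so only $k$ with the same parity as $b$ contribute. The integral $\int_0^{+\infty} f(x)\,dx$ is an improper Riemann integral at both ends: it converges if both $\lim_{\varepsilon\to 0^+}\int_\varepsilon^1 f(x)\,dx$ and $\lim_{R\to+\infty}\int_1^R f(x)\,dx$ exist and are finite. *)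

theory Defs
  imports "HOL-Analysis.Analysis"
begin

text \<open>
  Improper integrals over $(0, +\infty)$, improper at both ends. The proper integrals over the
  compact intervals are the library's gauge integrals; on integrands that are continuous on
  the open half-line they coincide with Riemann integrals.
\<close>

definition improper_integral_converges :: "(real \<Rightarrow> real) \<Rightarrow> bool" where
  "improper_integral_converges f \<longleftrightarrow>
     (\<forall>e. 0 < e \<and> e < 1 \<longrightarrow> f integrable_on {e..1}) \<and>
     (\<forall>R>1. f integrable_on {1..R}) \<and>
     (\<exists>l. ((\<lambda>e. integral {e..1} f) \<longlongrightarrow> l) (at_right 0)) \<and>
     (\<exists>l. ((\<lambda>R. integral {1..R} f) \<longlongrightarrow> l) at_top)"

definition improper_integral :: "(real \<Rightarrow> real) \<Rightarrow> real" where
  "improper_integral f =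
     Lim (at_right 0) (\<lambda>e. integral {e..1} f) + Lim at_top (\<lambda>R. integral {1..R} f)"

definition t_coeff :: "nat \<Rightarrow> nat \<Rightarrow> real" where
  "t_coeff b k = (1 + (-1) ^ (b - k)) * (-1) ^ (k div 2) / 2"

definition d_coeff :: "nat \<Rightarrow> nat \<Rightarrow> nat \<Rightarrow> real" where
  "d_coeff a b k =
     det (vector
       [vector [pi / 2, ln (real k)],
        vector [cos (real (a + b) * pi / 2), sin (real (a + b) * pi / 2)]] :: real ^ 2 ^ 2)"

lemma d_coeff_expand:
  "d_coeff a b k =
     pi / 2 * sin (real (a + b) * pi / 2) - ln (real k) * cos (real (a + b) * pi / 2)"
  by (simp add: d_coeff_def det_2)

text \<open>
  In the sums below the index \<open>(b - k) div 2\<close> is exact whenever \<open>b - k\<close> is even; otherwise the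
  term vanishes because of the following fact, whatever the binomial coefficient.
\<close>

lemma t_coeff_odd: "odd (b - k) \<Longrightarrow> t_coeff b k = 0"
  by (simp add: t_coeff_def)

end

theory Submission
  imports Defs "HOL-Probability.Sinc_Integral" "HOL-Real_Asymp.Real_Asymp"
begin

text \<open>
  If \<open>b \<le> a\<close>, the integrand dominates a multiple of \<open>1 / x\<close> near 0 and the integral diverges. If
  \<open>a < b\<close>, integrating by parts \<open>a\<close> times reduces the integral to \<open>1 / a!\<close> times that of \<open>g x / x\<close>,
  where \<open>g\<close> is the \<open>a\<close>-th derivative of \<open>sin x ^ b\<close>; the boundary terms vanish because the
  \<open>j\<close>-th derivative has a zero of order \<open>b - j\<close> at 0. Expanding \<open>sin x ^ b\<close> into frequencies
  \<open>b - 2 * i\<close> makes \<open>g\<close> a sum of terms \<open>A * cos (w * x + \<phi>)\<close> with a common phase. Since \<open>g 0 = 0\<close>,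
  its cosine parts integrate by Frullani's formula, and its sine parts by the Dirichlet integral. As
  \<open>\<phi>\<close> is a multiple of \<open>\<pi> / 2\<close>, only one of the two kinds occurs, which makes the signs global.
  The absolute value is removed by pairing \<open>x\<close> with \<open>x + \<pi>\<close>, which shows that the integral is
  nonnegative.
\<close>

section \<open>Improper integrals through antiderivatives\<close>

text \<open>Working with the limits of an antiderivative on the open half-line turns linearity and
  integration by parts into statements about derivatives and limits; the compact integrals are
  recovered later by the fundamental theorem of calculus.\<close>

definition has_improper_integral :: "(real \<Rightarrow> real) \<Rightarrow> real \<Rightarrow> bool" where
  "has_improper_integral f v \<longleftrightarrow>
     (\<exists>F l u. (\<forall>x>0. (F has_real_derivative f x) (at x)) \<and>
        (F \<longlongrightarrow> l) (at_right 0) \<and> (F \<longlongrightarrow> u) at_top \<and> v = u - l)"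

lemma has_improper_integralI:
  assumes "\<And>x. x > 0 \<Longrightarrow> (F has_real_derivative f x) (at x)"
    and "(F \<longlongrightarrow> l) (at_right 0)" and "(F \<longlongrightarrow> u) at_top" and "v = u - l"
  shows "has_improper_integral f v"
  unfolding has_improper_integral_def using assms by blast

lemma has_improper_integralE:
  assumes "has_improper_integral f v"
  obtains F l u where "\<And>x. x > 0 \<Longrightarrow> (F has_real_derivative f x) (at x)"
    and "(F \<longlongrightarrow> l) (at_right 0)" and "(F \<longlongrightarrow> u) at_top" and "v = u - l"
  using assms unfolding has_improper_integral_def by blast

lemma has_improper_integral_zero: "has_improper_integral (\<lambda>x. 0) 0"
  by (rule has_improper_integralI[where F = "\<lambda>x. 0"]) auto

lemma has_improper_integral_add:
  assumes "has_improper_integral f v" and "has_improper_integral g w"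
  shows "has_improper_integral (\<lambda>x. f x + g x) (v + w)"
proof -
  from assms(1) obtain F l u where F: "\<And>x. x > 0 \<Longrightarrow> (F has_real_derivative f x) (at x)"
    "(F \<longlongrightarrow> l) (at_right 0)" "(F \<longlongrightarrow> u) at_top" "v = u - l"
    by (rule has_improper_integralE) blast
  from assms(2) obtain G m r where G: "\<And>x. x > 0 \<Longrightarrow> (G has_real_derivative g x) (at x)"
    "(G \<longlongrightarrow> m) (at_right 0)" "(G \<longlongrightarrow> r) at_top" "w = r - m"
    by (rule has_improper_integralE) blast
  show ?thesis
    by (rule has_improper_integralI[where F = "\<lambda>x. F x + G x" and l = "l + m" and u = "u + r"])
      (use F G in \<open>auto intro!: derivative_intros tendsto_intros\<close>)
qed

lemma has_improper_integral_cmult: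
  assumes "has_improper_integral f v"
  shows "has_improper_integral (\<lambda>x. c * f x) (c * v)"
proof -
  from assms obtain F l u where F: "\<And>x. x > 0 \<Longrightarrow> (F has_real_derivative f x) (at x)"
    "(F \<longlongrightarrow> l) (at_right 0)" "(F \<longlongrightarrow> u) at_top" "v = u - l"
    by (rule has_improper_integralE) blast
  show ?thesis
    by (rule has_improper_integralI[where F = "\<lambda>x. c * F x" and l = "c * l" and u = "c * u"])
      (use F in \<open>auto intro!: tendsto_intros DERIV_cmult simp: algebra_simps\<close>)
qed

lemma has_improper_integral_sum:
  assumes "finite I" and "\<And>i. i \<in> I \<Longrightarrow> has_improper_integral (f i) (v i)"
  shows "has_improper_integral (\<lambda>x. \<Sum>i\<in>I. f i x) (\<Sum>i\<in>I. v i)"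
  using assms
  by (induction I) (auto intro: has_improper_integral_zero has_improper_integral_add)

text \<open>If \<open>F\<close> is an antiderivative of \<open>f' x / x ^ n\<close>, then
  \<open>(F x - f x / x ^ n) / n\<close> is one of \<open>f x / x ^ (n + 1)\<close>; the limits
  \<open>lim\<close> remove the boundary term at both ends.\<close>

lemma has_improper_integral_parts:
  assumes "n > 0" and df: "\<And>x. x > 0 \<Longrightarrow> (f has_real_derivative f' x) (at x)"
    and "has_improper_integral (\<lambda>x. f' x / x ^ n) v"
    and lim: "((\<lambda>x. f x / x ^ n) \<longlongrightarrow> 0) (at_right 0)" "((\<lambda>x. f x / x ^ n) \<longlongrightarrow> 0) at_top"
  shows "has_improper_integral (\<lambda>x. f x / x ^ (n + 1)) (v / n)"
proof -
  from assms(3) obtain F l u where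
    F: "\<And>x. x > 0 \<Longrightarrow> (F has_real_derivative f' x / x ^ n) (at x)"
    "(F \<longlongrightarrow> l) (at_right 0)" "(F \<longlongrightarrow> u) at_top" "v = u - l"
    by (rule has_improper_integralE) blast
  show ?thesis
  proof (rule has_improper_integralI)
    show "((\<lambda>x. (F x - f x / x ^ n) / n) has_real_derivative f x / x ^ (n + 1)) (at x)"
      if "x > 0" for x
    proof -
      from \<open>n > 0\<close> obtain m where m: "n = Suc m" by (cases n) auto
      have "((\<lambda>x. (F x - f x / x ^ n) / n) has_real_derivative
         (f' x / x ^ n - (f' x * x ^ n - f x * (real n * x ^ (n - 1))) / (x ^ n * x ^ n)) / n) (at x)"
        using that \<open>n > 0\<close> by (auto intro!: derivative_eq_intros F(1) df)
      moreover have "(f' x / x ^ n - (f' x * x ^ n - f x * (real n * x ^ (n - 1))) / (x ^ n * x ^ n)) / n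
          = f x / x ^ (n + 1)"
        using that by (simp add: m field_simps del: of_nat_Suc)
      ultimately show ?thesis by simp
    qed
    show "((\<lambda>x. (F x - f x / x ^ n) / n) \<longlongrightarrow> (l - 0) / n) (at_right 0)"
      "((\<lambda>x. (F x - f x / x ^ n) / n) \<longlongrightarrow> (u - 0) / n) at_top"
      using \<open>n > 0\<close> by (intro tendsto_intros F lim; simp)+
  qed (simp add: F(4) diff_divide_distrib)
qed

text \<open>The two halves tend to \<open>F 1 - l\<close> and \<open>u - F 1\<close>, and
  \<open>F 1\<close> cancels in their sum.\<close>

lemma has_improper_integral_imp_eq:
  assumes "has_improper_integral f v"
  shows "improper_integral f = v"
proof -
  from assms obtain F l u where F: "\<And>x. x > 0 \<Longrightarrow> (F has_real_derivative f x) (at x)"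
    "(F \<longlongrightarrow> l) (at_right 0)" "(F \<longlongrightarrow> u) at_top" "v = u - l"
    by (rule has_improper_integralE) blast
  have int: "integral {x..y} f = F y - F x" if "0 < x" "x \<le> y" for x y
    by (rule integral_unique, rule fundamental_theorem_of_calculus)
      (use that F(1) in \<open>auto simp: has_real_derivative_iff_has_vector_derivative[symmetric]
        intro: has_field_derivative_at_within\<close>)
  have "\<forall>\<^sub>F x in at_right 0. x > 0 \<and> x < (1::real)"
    by (rule eventually_at_rightI[of 0 1]) auto
  then have "\<forall>\<^sub>F x in at_right 0. F 1 - F x = integral {x..1} f"
    by eventually_elim (simp add: int)
  then have "((\<lambda>x. integral {x..1} f) \<longlongrightarrow> F 1 - l) (at_right 0)"
    by (rule Lim_transform_eventually[rotated]) (intro tendsto_intros F)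
  moreover have "\<forall>\<^sub>F x in at_top. F x - F 1 = integral {1..x} f"
    using eventually_ge_at_top[of 1] by eventually_elim (simp add: int)
  then have "((\<lambda>x. integral {1..x} f) \<longlongrightarrow> u - F 1) at_top"
    by (rule Lim_transform_eventually[rotated]) (intro tendsto_intros F)
  ultimately show ?thesis
    unfolding improper_integral_def by (simp add: tendsto_Lim F(4))
qed

section \<open>Zeros at the origin and boundary terms\<close>

text \<open>
  Trigonometric polynomials that vanish to order \<open>m\<close> at 0, given as combinations of monomials
  divisible by \<open>sin x ^ m\<close>: differentiation visibly lowers the order by one.
\<close>

inductive trig_vanishing :: "nat \<Rightarrow> (real \<Rightarrow> real) \<Rightarrow> bool" where
  base: "m \<le> i \<Longrightarrow> trig_vanishing m (\<lambda>x. sin x ^ i * cos x ^ j)"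
| add: "trig_vanishing m f \<Longrightarrow> trig_vanishing m g \<Longrightarrow> trig_vanishing m (\<lambda>x. f x + g x)"
| scale: "trig_vanishing m f \<Longrightarrow> trig_vanishing m (\<lambda>x. c * f x)"

text \<open>Rests on the sine being bounded both by 1 and by the absolute value of its argument. The
  constant bound controls boundary terms at infinity, the power bound those at 0.\<close>

lemma trig_vanishing_bound:
  assumes "trig_vanishing m f"
  shows "\<exists>C\<ge>0. \<forall>x. \<bar>f x\<bar> \<le> C \<and> \<bar>f x\<bar> \<le> C * \<bar>x\<bar> ^ m"
  using assms
proof induction
  case (base m i j)
  have "\<bar>sin x ^ i * cos x ^ j\<bar> \<le> \<bar>x\<bar> ^ m" for x :: real
  proof -
    have "\<bar>sin x ^ i * cos x ^ j\<bar> \<le> \<bar>sin x\<bar> ^ i * 1"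
      unfolding abs_mult power_abs by (intro mult_left_mono) (auto simp: power_le_one)
    also have "\<dots> \<le> \<bar>sin x\<bar> ^ m"
      using base by (simp add: power_decreasing)
    also have "\<dots> \<le> \<bar>x\<bar> ^ m"
      by (intro power_mono abs_sin_x_le_abs_x) auto
    finally show ?thesis .
  qed
  moreover have "\<bar>sin x ^ i * cos x ^ j\<bar> \<le> 1" for x :: real
    unfolding abs_mult power_abs by (intro mult_le_one) (auto simp: power_le_one)
  ultimately show ?case by (intro exI[of _ 1]) auto
next
  case (add m f g)
  then obtain C D where "C \<ge> 0" "D \<ge> 0"
    "\<And>x. \<bar>f x\<bar> \<le> C \<and> \<bar>f x\<bar> \<le> C * \<bar>x\<bar> ^ m" "\<And>x. \<bar>g x\<bar> \<le> D \<and> \<bar>g x\<bar> \<le> D * \<bar>x\<bar> ^ m"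
    by blast
  then show ?case
    by (intro exI[of _ "C + D"]) (auto simp: distrib_right intro!: order_trans[OF abs_triangle_ineq] add_mono)
next
  case (scale m f c)
  then obtain C where "C \<ge> 0" "\<And>x. \<bar>f x\<bar> \<le> C \<and> \<bar>f x\<bar> \<le> C * \<bar>x\<bar> ^ m"
    by blast
  then show ?case
    by (intro exI[of _ "\<bar>c\<bar> * C"]) (auto simp: abs_mult mult.assoc intro!: mult_left_mono)
qed

lemma trig_vanishing_deriv:
  assumes "trig_vanishing (Suc m) f"
  shows "\<exists>f'. (\<forall>x. (f has_real_derivative f' x) (at x)) \<and> trig_vanishing m f'"
  using assms
proof (induction "Suc m" f)
  case (base i j)
  \<comment> \<open>Both terms of the product rule keep at least \<open>i - 1 \<ge> m\<close>
    factors of sine. The truncated \<open>j - 1\<close> is harmless at \<open>j = 0\<close>, where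
    its coefficient vanishes.\<close>
  let ?f' = "\<lambda>x. real i * (sin x ^ (i - 1) * cos x ^ Suc j)
      + (- real j) * (sin x ^ Suc i * cos x ^ (j - 1))"
  have "((\<lambda>x. sin x ^ i * cos x ^ j) has_real_derivative ?f' x) (at x)" for x :: real
    by (auto intro!: derivative_eq_intros simp: algebra_simps)
  moreover have "trig_vanishing m ?f'"
    using base by (intro trig_vanishing.intros) auto
  ultimately show ?case by (intro exI[of _ ?f']) blast
next
  case (add f g)
  then obtain f' g' where "\<And>x. (f has_real_derivative f' x) (at x)" "trig_vanishing m f'"
    "\<And>x. (g has_real_derivative g' x) (at x)" "trig_vanishing m g'" by blast
  then show ?case
    by (intro exI[of _ "\<lambda>x. f' x + g' x"]) (auto intro: trig_vanishing.intros derivative_intros)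
next
  case (scale f c)
  then obtain f' where "\<And>x. (f has_real_derivative f' x) (at x)" "trig_vanishing m f'" by blast
  then show ?case
    by (intro exI[of _ "\<lambda>x. c * f' x"]) (auto intro: trig_vanishing.intros DERIV_cmult)
qed

lemma trig_vanishing_zero: "trig_vanishing (Suc m) f \<Longrightarrow> f 0 = 0"
  by (drule trig_vanishing_bound) (auto dest: spec[of _ 0])

lemma trig_vanishing_lim_0:
  assumes "trig_vanishing m f" and "n < m"
  shows "((\<lambda>x. f x / x ^ n) \<longlongrightarrow> 0) (at_right 0)"
proof -
  from trig_vanishing_bound[OF assms(1)] obtain C where
    C: "C \<ge> 0" "\<And>x. \<bar>f x\<bar> \<le> C * \<bar>x\<bar> ^ m" by blast
  have "((\<lambda>x. C * x ^ (m - n)) \<longlongrightarrow> C * 0 ^ (m - n)) (at_right (0::real))"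
    by (intro tendsto_intros)
  moreover have "C * 0 ^ (m - n) = 0"
    using \<open>n < m\<close> by (simp add: power_0_left)
  ultimately have lim: "((\<lambda>x. C * x ^ (m - n)) \<longlongrightarrow> 0) (at_right (0::real))"
    by metis
  have "\<forall>\<^sub>F x in at_right (0::real). x > 0"
    by (rule eventually_at_right_less)
  then have "\<forall>\<^sub>F x in at_right 0. norm (f x / x ^ n) \<le> C * x ^ (m - n)"
  proof eventually_elim
    case (elim x)
    have "x ^ m = x ^ (m - n) * x ^ n"
      using \<open>n < m\<close> by (simp flip: power_add)
    then show ?case using C(2)[of x] elim by (simp add: field_simps)
  qed
  then show ?thesis by (rule Lim_null_comparison[OF _ lim])
qed

lemma trig_vanishing_lim_top:
  assumes "trig_vanishing m f" and "n > 0"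
  shows "((\<lambda>x. f x / x ^ n) \<longlongrightarrow> 0) at_top"
proof -
  from trig_vanishing_bound[OF assms(1)] obtain C where
    C: "C \<ge> 0" "\<And>x. \<bar>f x\<bar> \<le> C" by blast
  have lim: "((\<lambda>x::real. C / x ^ n) \<longlongrightarrow> 0) at_top"
    by (intro real_tendsto_divide_at_top[where c = C] tendsto_intros filterlim_pow_at_top filterlim_ident assms)
  have "\<forall>\<^sub>F x in at_top. norm (f x / x ^ n) \<le> C / x ^ n"
    using eventually_gt_at_top[of 0] by eventually_elim (auto intro!: divide_right_mono C)
  then show ?thesis by (rule Lim_null_comparison[OF _ lim])
qed

section \<open>Repeated integration by parts\<close>

text \<open>Each step trades a power of x for a derivative and one order of vanishing:
  \<open>j\<close> grows while \<open>n\<close> and \<open>m\<close> drop together. So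
  \<open>n < m\<close> persists, which makes the boundary term at 0 vanish at every stage.\<close>

lemma has_improper_integral_iterated_parts:
  assumes "\<And>j x. (g j has_real_derivative g (Suc j) x) (at x)"
    and "trig_vanishing m (g j)" and "n < m"
    and "has_improper_integral (\<lambda>x. g (j + n) x / x) v"
  shows "has_improper_integral (\<lambda>x. g j x / x ^ (n + 1)) (v / fact n)"
  using assms(2-4)
proof (induction n arbitrary: j m)
  case 0
  then show ?case by simp
next
  case (Suc n)
  obtain m' where m': "m = Suc m'"
    using Suc.prems(2) by (cases m) auto
  with trig_vanishing_deriv Suc.prems obtain f' where
    f': "\<forall>x. (g j has_real_derivative f' x) (at x)" "trig_vanishing m' f'" by blast
  \<comment> \<open>The derivative obtained above is only known to exist; uniqueness identifies it
    with the next member of the family.\<close>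
  then have "f' = g (Suc j)"
    using assms(1) DERIV_unique by blast
  with f' Suc.prems m' have "has_improper_integral (\<lambda>x. g (Suc j) x / x ^ (n + 1)) (v / fact n)"
    by (intro Suc.IH[of m']) auto
  then have "has_improper_integral (\<lambda>x. g j x / x ^ (Suc n + 1)) (v / fact n / Suc n)"
    using Suc.prems
    by (intro has_improper_integral_parts[where f' = "g (Suc j)"] assms(1)
      trig_vanishing_lim_0[of m] trig_vanishing_lim_top[of m]) auto
  then show ?case by (simp add: field_simps)
qed

lemma trig_vanishing_iterated_deriv:
  assumes "\<And>j x. (g j has_real_derivative g (Suc j) x) (at x)"
    and "trig_vanishing m (g 0)" and "n \<le> m"
  shows "trig_vanishing (m - n) (g n)"
  using assms(3)
proof (induction n)
  case 0
  then show ?case using assms by simp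
next
  case (Suc n)
  then have "trig_vanishing (Suc (m - Suc n)) (g n)"
    by (simp add: Suc_diff_Suc)
  with trig_vanishing_deriv obtain f' where
    f': "\<forall>x. (g n has_real_derivative f' x) (at x)" "trig_vanishing (m - Suc n) f'" by blast
  then have "f' = g (Suc n)"
    using assms(1) DERIV_unique by blast
  with f' show ?case by simp
qed

section \<open>Frullani and Dirichlet integrals\<close>

lemma abs_cos_minus_one_le: "\<bar>cos x - 1\<bar> \<le> \<bar>x\<bar>" for x :: real
proof -
  have "cos x - 1 = - 2 * (sin (x / 2))\<^sup>2"
    using cos_double_sin[of "x / 2"] by simp
  then have "\<bar>cos x - 1\<bar> = 2 * (\<bar>sin (x / 2)\<bar> * \<bar>sin (x / 2)\<bar>)"
    by (simp add: abs_mult power2_eq_square)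
  also have "\<dots> \<le> 2 * (\<bar>x / 2\<bar> * 1)"
    by (intro mult_left_mono mult_mono abs_sin_x_le_abs_x) auto
  finally show ?thesis by simp
qed

text \<open>With \<open>F\<close> any antiderivative of \<open>cos x / x\<close>, the integrand has
  antiderivative \<open>F (w * x) - F x\<close>. Its limits follow by correcting \<open>F\<close>
  with a function that makes the derivative small: \<open>ln x\<close> near 0, giving the limit
  \<open>ln w\<close>, and \<open>sin x / x\<close> near infinity, giving the limit 0.\<close>

lemma has_improper_integral_cos_Frullani:
  assumes "w > 0"
  shows "has_improper_integral (\<lambda>x. (cos (w * x) - cos x) / x) (- ln w)"
proof -
  have "\<exists>F. \<forall>x::real. 0 < ereal x \<longrightarrow> ereal x < \<infinity> \<longrightarrow> (F has_vector_derivative cos x / x) (at x)"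
    by (rule einterval_antiderivative) (auto intro!: continuous_intros)
  then obtain F where F: "\<And>x::real. x > 0 \<Longrightarrow> (F has_real_derivative cos x / x) (at x)"
    by (auto simp: has_real_derivative_iff_has_vector_derivative)
  \<comment> \<open>Mean value estimate: \<open>F x - ln x\<close> has derivative
    \<open>(cos x - 1) / x\<close>, bounded by 1.\<close>
  have near: "\<bar>F (w * x) - F x - ln w\<bar> \<le> \<bar>w - 1\<bar> * x" if "x > 0" for x
  proof -
    have "norm ((F (w * x) - ln (w * x)) - (F x - ln x)) \<le> 1 * norm (w * x - x)"
    proof (rule field_differentiable_bound[where S = "{0<..}"])
      show "((\<lambda>x. F x - ln x) has_field_derivative (cos y - 1) / y) (at y within {0<..})"
        if "y \<in> {0<..}" for y
        using that by (auto intro!: derivative_eq_intros F[THEN has_field_derivative_at_within]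
            simp: diff_divide_distrib)
      show "norm ((cos y - 1) / y) \<le> 1" if "y \<in> {0<..}" for y :: real
        using abs_cos_minus_one_le[of y] that by (simp add: field_simps)
    qed (use that assms in auto)
    also have "norm (w * x - x) = \<bar>w - 1\<bar> * x"
      using that by (simp add: abs_mult flip: left_diff_distrib [of w 1 x, simplified])
    finally show ?thesis using that assms by (simp add: ln_mult algebra_simps)
  qed
  \<comment> \<open>Both \<open>x\<close> and \<open>w * x\<close> lie in \<open>{c * x..}\<close>,
    on which the derivative \<open>sin y / y\<^sup>2\<close> of the corrected function is at most
    \<open>1 / (c * x)\<^sup>2\<close>.\<close>
  define c where "c = min 1 w"
  have c: "c > 0" "c \<le> 1" "c \<le> w" using assms by (auto simp: c_def)
  have far: "\<bar>(F (w * x) - sin (w * x) / (w * x)) - (F x - sin x / x)\<bar> \<le> \<bar>w - 1\<bar> / c\<^sup>2 / x" if "x > 0" for x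
  proof -
    have "norm ((F (w * x) - sin (w * x) / (w * x)) - (F x - sin x / x))
        \<le> 1 / (c * x)\<^sup>2 * norm (w * x - x)"
    proof (rule field_differentiable_bound[where S = "{c * x..}"])
      show "((\<lambda>x. F x - sin x / x) has_field_derivative sin y / y\<^sup>2) (at y within {c * x..})"
        if y: "y \<in> {c * x..}" for y
      proof -
        have "y > 0" using y c \<open>x > 0\<close> by (auto intro: less_le_trans[OF mult_pos_pos])
        then show ?thesis
          by (auto intro!: derivative_eq_intros F[THEN has_field_derivative_at_within]
              simp: field_simps power2_eq_square)
      qed
      show "norm (sin y / y\<^sup>2) \<le> 1 / (c * x)\<^sup>2" if y: "y \<in> {c * x..}" for y :: real
      proof -
        have "c * x > 0" using c \<open>x > 0\<close> by simp
        then have "norm (sin y / y\<^sup>2) \<le> 1 / y\<^sup>2"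
          by (auto intro!: divide_right_mono)
        also have "\<dots> \<le> 1 / (c * x)\<^sup>2"
        proof (rule divide_left_mono)
          show "(c * x)\<^sup>2 \<le> y\<^sup>2"
            using y \<open>c * x > 0\<close> by (intro power_mono) auto
          have "y > 0"
            using y \<open>c * x > 0\<close> by (meson atLeast_iff less_le_trans)
          with \<open>c * x > 0\<close> show "0 < y\<^sup>2 * (c * x)\<^sup>2"
            by (intro mult_pos_pos[OF zero_less_power zero_less_power])
        qed simp
        finally show ?thesis .
      qed
    qed (use that c in auto)
    also have "norm (w * x - x) = \<bar>w - 1\<bar> * x"
      using that by (simp add: abs_mult flip: left_diff_distrib [of w 1 x, simplified])
    also have "1 / (c * x)\<^sup>2 * (\<bar>w - 1\<bar> * x) = \<bar>w - 1\<bar> / c\<^sup>2 / x"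
      using that c by (simp add: field_simps power2_eq_square)
    finally show ?thesis by simp
  qed
  show ?thesis
  proof (rule has_improper_integralI)
    show "((\<lambda>x. F (w * x) - F x) has_real_derivative (cos (w * x) - cos x) / x) (at x)"
      if "x > 0" for x
    proof -
      have "((\<lambda>x. F (w * x)) has_real_derivative cos (w * x) / (w * x) * w) (at x)"
        by (rule DERIV_chain2[where g = "\<lambda>x. w * x"])
          (use that assms in \<open>auto intro!: F derivative_eq_intros\<close>)
      from DERIV_diff[OF this F[OF that]] show ?thesis
        using that assms by (simp add: field_simps)
    qed
    have "((\<lambda>x. F (w * x) - F x - ln w) \<longlongrightarrow> 0) (at_right 0)"
    proof (rule Lim_null_comparison)
      show "\<forall>\<^sub>F x in at_right 0. norm (F (w * x) - F x - ln w) \<le> \<bar>w - 1\<bar> * x"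
        using eventually_at_right_less[of 0] by eventually_elim (simp add: near)
      show "((\<lambda>x. \<bar>w - 1\<bar> * x) \<longlongrightarrow> 0) (at_right 0)"
        by (auto intro!: tendsto_eq_intros)
    qed
    then show "((\<lambda>x. F (w * x) - F x) \<longlongrightarrow> ln w) (at_right 0)"
      by (rule LIM_zero_cancel)
    have e: "((\<lambda>x. (F (w * x) - sin (w * x) / (w * x)) - (F x - sin x / x)) \<longlongrightarrow> 0) at_top"
    proof (rule Lim_null_comparison)
      show "\<forall>\<^sub>F x in at_top. norm ((F (w * x) - sin (w * x) / (w * x)) - (F x - sin x / x))
          \<le> \<bar>w - 1\<bar> / c\<^sup>2 / x"
        using eventually_gt_at_top[of 0] by eventually_elim (unfold real_norm_def, rule far)
      show "((\<lambda>x. \<bar>w - 1\<bar> / c\<^sup>2 / x) \<longlongrightarrow> 0) at_top"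
        by (intro real_tendsto_divide_at_top[OF tendsto_const filterlim_ident])
    qed
    have s: "((\<lambda>x::real. sin x / x) \<longlongrightarrow> 0) at_top"
    proof (rule Lim_null_comparison)
      show "\<forall>\<^sub>F x in at_top. norm (sin x / x) \<le> 1 / (x::real)"
        using eventually_gt_at_top[of 0] by eventually_elim (auto intro!: divide_right_mono)
      show "((\<lambda>x::real. 1 / x) \<longlongrightarrow> 0) at_top"
        by (intro real_tendsto_divide_at_top[OF tendsto_const filterlim_ident])
    qed
    moreover have "((\<lambda>x. sin (w * x) / (w * x)) \<longlongrightarrow> 0) at_top"
      by (rule filterlim_compose[OF s])
        (use assms in \<open>auto intro!: filterlim_tendsto_pos_mult_at_top[OF tendsto_const] filterlim_ident\<close>)
    ultimately have "((\<lambda>x. ((F (w * x) - sin (w * x) / (w * x)) - (F x - sin x / x))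
        + sin (w * x) / (w * x) - sin x / x) \<longlongrightarrow> 0 + 0 - 0) at_top"
      using e by (intro tendsto_intros)
    then show "((\<lambda>x. F (w * x) - F x) \<longlongrightarrow> 0) at_top" by simp
  qed simp
qed

text \<open>For positive \<open>w\<close> the antiderivative is \<open>Si (w * x)\<close>, with
  limit \<open>pi / 2\<close> at infinity; \<open>sgn\<close> covers the zero integrand and, by
  oddness, negative frequencies.\<close>

lemma has_improper_integral_sin:
  "has_improper_integral (\<lambda>x. sin (w * x) / x) (pi / 2 * sgn w)"
proof -
  have pos: "has_improper_integral (\<lambda>x. sin (w * x) / x) (pi / 2)" if "w > 0" for w :: real
  proof (rule has_improper_integralI)
    show "((\<lambda>x. Si (w * x)) has_real_derivative sin (w * x) / x) (at x)" if "x > 0" for x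
    proof -
      have "((\<lambda>x. Si (w * x)) has_real_derivative sinc (w * x) * w) (at x)"
        by (rule DERIV_chain2[where g = "\<lambda>x. w * x", OF DERIV_Si]) (auto intro!: derivative_eq_intros)
      then show ?thesis using that \<open>w > 0\<close> by simp
    qed
    have "isCont (\<lambda>x. Si (w * x)) 0"
      by (intro isCont_o2[OF _ isCont_Si] continuous_intros)
    then have "((\<lambda>x. Si (w * x)) \<longlongrightarrow> Si (w * 0)) (at 0)"
      by (simp add: isCont_def)
    moreover have "Si 0 = 0" using Si_neg[of 0] by simp
    ultimately show "((\<lambda>x. Si (w * x)) \<longlongrightarrow> 0) (at_right 0)"
      by (auto intro: tendsto_within_subset)
    show "((\<lambda>x. Si (w * x)) \<longlongrightarrow> pi / 2) at_top"
      by (rule filterlim_compose[OF Si_at_top])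
        (use that in \<open>auto intro!: filterlim_tendsto_pos_mult_at_top[OF tendsto_const] filterlim_ident\<close>)
  qed simp
  consider "w > 0" | "w = 0" | "w < 0" by linarith
  then show ?thesis
  proof cases
    case 1
    then show ?thesis using pos by simp
  next
    case 2
    then show ?thesis using has_improper_integral_zero by simp
  next
    case 3
    then have "has_improper_integral (\<lambda>x. - 1 * (sin (- w * x) / x)) (- 1 * (pi / 2))"
      by (intro has_improper_integral_cmult pos) auto
    then show ?thesis using 3 by simp
  qed
qed

text \<open>The addition formula splits each term into a cosine and a sine part. A single cosine
  part over x diverges at 0, but as the weights sum to 0 a common \<open>cos x\<close> can be
  subtracted from all of them. A zero frequency would then leave \<open>(1 - cos x) / x\<close>,
  divergent at infinity, so its coefficient has to vanish.\<close>

lemma has_improper_integral_cos_sum: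
  fixes A w :: "'a \<Rightarrow> real"
  assumes "finite I" and "\<And>i. i \<in> I \<Longrightarrow> w i = 0 \<Longrightarrow> A i = 0" and "(\<Sum>i\<in>I. A i * cos \<phi>) = 0"
  shows "has_improper_integral (\<lambda>x. (\<Sum>i\<in>I. A i * cos (w i * x + \<phi>)) / x)
    (- (\<Sum>i\<in>I. A i * (pi / 2 * sgn (w i) * sin \<phi> + ln \<bar>w i\<bar> * cos \<phi>)))"
proof -
  have "has_improper_integral (\<lambda>x. A i * cos \<phi> * ((cos (w i * x) - cos x) / x)
      + - (A i * sin \<phi>) * (sin (w i * x) / x))
      (A i * cos \<phi> * (- ln \<bar>w i\<bar>) + - (A i * sin \<phi>) * (pi / 2 * sgn (w i)))"
    if "i \<in> I" for i
  proof (cases "w i = 0")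
    case True
    then show ?thesis using assms(2)[OF that] has_improper_integral_zero by simp
  next
    case False
    have "cos (\<bar>w i\<bar> * x) = cos (w i * x)" for x
      by (cases "w i \<ge> 0") auto
    then show ?thesis
      using has_improper_integral_cos_Frullani[of "\<bar>w i\<bar>"] False
      by (intro has_improper_integral_add has_improper_integral_cmult has_improper_integral_sin) simp
  qed
  from has_improper_integral_sum[OF assms(1) this]
  have *: "has_improper_integral
    (\<lambda>x. \<Sum>i\<in>I. A i * cos \<phi> * ((cos (w i * x) - cos x) / x) + - (A i * sin \<phi>) * (sin (w i * x) / x))
    (\<Sum>i\<in>I. A i * cos \<phi> * (- ln \<bar>w i\<bar>) + - (A i * sin \<phi>) * (pi / 2 * sgn (w i)))" .
  have "(\<Sum>i\<in>I. A i * cos \<phi> * ((cos (w i * x) - cos x) / x) + - (A i * sin \<phi>) * (sin (w i * x) / x))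
      = (\<Sum>i\<in>I. A i * cos (w i * x + \<phi>)) / x" for x
  proof -
    have "(\<Sum>i\<in>I. A i * cos \<phi> * ((cos (w i * x) - cos x) / x) + - (A i * sin \<phi>) * (sin (w i * x) / x))
      = (\<Sum>i\<in>I. A i * cos (w i * x + \<phi>) / x - A i * cos \<phi> * (cos x / x))"
      by (intro sum.cong) (auto simp: cos_add diff_divide_distrib algebra_simps)
    also have "\<dots> = (\<Sum>i\<in>I. A i * cos (w i * x + \<phi>)) / x - (\<Sum>i\<in>I. A i * cos \<phi>) * (cos x / x)"
      by (simp only: sum_subtractf sum_divide_distrib sum_distrib_right)
    finally show ?thesis by (simp add: assms(3))
  qed
  moreover have "(\<Sum>i\<in>I. A i * cos \<phi> * (- ln \<bar>w i\<bar>) + - (A i * sin \<phi>) * (pi / 2 * sgn (w i)))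
     = - (\<Sum>i\<in>I. A i * (pi / 2 * sgn (w i) * sin \<phi> + ln \<bar>w i\<bar> * cos \<phi>))"
    by (simp add: algebra_simps sum_negf flip: sum_negf sum.distrib)
  ultimately show ?thesis using * by simp
qed

section \<open>Frequency expansion of the power of sine\<close>

text \<open>Euler's formula with 1 / i written as \<open>cis (- pi / 2)\<close>, then the binomial
  theorem and real parts. Keeping this factor as a phase avoids a case split on the parity of
  \<open>b\<close>.\<close>

lemma sin_power_expansion:
  "sin x ^ b = (\<Sum>i\<le>b. real (b choose i) * (-1) ^ i * cos ((real b - 2 * real i) * x - real b * pi / 2)) / 2 ^ b"
proof -
  have "complex_of_real (sin x) = (- cis (- x) + cis x) * cis (- pi / 2) / 2"
    by (simp add: complex_eq_iff)
  then have "complex_of_real (sin x ^ b) = ((- cis (- x) + cis x) * cis (- pi / 2) / 2) ^ b"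
    by (simp only: of_real_power)
  also have "\<dots> = (- cis (- x) + cis x) ^ b * cis (- (real b * pi / 2)) / 2 ^ b"
    unfolding power_divide power_mult_distrib Complex.DeMoivre by simp
  also have "(- cis (- x) + cis x) ^ b =
      (\<Sum>i\<le>b. of_nat (b choose i) * (- cis (- x)) ^ i * cis x ^ (b - i))"
    by (rule binomial_ring)
  also have "\<dots> = (\<Sum>i\<le>b. of_nat (b choose i) * (-1) ^ i * cis ((real b - 2 * real i) * x))"
  proof (intro sum.cong refl)
    fix i assume i: "i \<in> {..b}"
    have "(- cis (- x)) ^ i = (-1) ^ i * cis (- x) ^ i"
      by (rule power_minus)
    then have "(- cis (- x)) ^ i * cis x ^ (b - i) = (-1) ^ i * (cis (real i * - x) * cis (real (b - i) * x))"
      by (simp add: Complex.DeMoivre)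
    also have "cis (real i * - x) * cis (real (b - i) * x) = cis ((real b - 2 * real i) * x)"
      using i by (simp add: cis_mult of_nat_diff algebra_simps)
    finally show "of_nat (b choose i) * (- cis (- x)) ^ i * cis x ^ (b - i)
        = of_nat (b choose i) * (-1) ^ i * cis ((real b - 2 * real i) * x)"
      by (simp add: mult.assoc)
  qed
  also have "\<dots> * cis (- (real b * pi / 2)) =
      (\<Sum>i\<le>b. of_real (real (b choose i) * (-1) ^ i) * cis ((real b - 2 * real i) * x - real b * pi / 2))"
    by (simp add: sum_distrib_right mult.assoc cis_mult)
  finally have "Re (complex_of_real (sin x ^ b)) = Re ((\<Sum>i\<le>b. of_real (real (b choose i) * (-1) ^ i)
      * cis ((real b - 2 * real i) * x - real b * pi / 2)) / of_real (2 ^ b))"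
    by simp
  then show ?thesis
    unfolding Re_divide_of_real Re_sum by simp
qed

section \<open>Nonnegativity of the integral\<close>

text \<open>In each period the second half carries the sine with opposite sign over a larger
  denominator, so it cannot outweigh the first half. Hence \<open>F\<close> does not decrease from
  one multiple of \<open>2 * pi\<close> to the next.\<close>

lemma has_improper_integral_sin_power_nonneg:
  assumes "has_improper_integral (\<lambda>x. sin x ^ b / x ^ n) v"
  shows "v \<ge> 0"
proof -
  from assms obtain F l u where F: "\<And>x. x > 0 \<Longrightarrow> (F has_real_derivative sin x ^ b / x ^ n) (at x)"
    "(F \<longlongrightarrow> l) (at_right 0)" "(F \<longlongrightarrow> u) at_top" "v = u - l"
    by (rule has_improper_integralE) blast
  have shift: "((\<lambda>x. F (x + c)) has_real_derivative sin (x + c) ^ b / (x + c) ^ n) (at x)"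
    if "x + c > 0" for x c
    using F(1)[OF that] unfolding DERIV_shift .
  \<comment> \<open>The left end enters as a right-hand limit \<open>p\<close>, so that the first
    period, where only the limit \<open>l\<close> at 0 is known, is treated like the others.\<close>
  have period: "p \<le> F (c + 2 * pi)"
    if lim: "((\<lambda>x. F (x + c)) \<longlongrightarrow> p) (at_right 0)" and c: "c = 2 * real m * pi" for p c m
  proof -
    have "c \<ge> 0" using c by simp
    have mono: "F (x + c) + F (x + (c + pi)) \<le> F (pi + c) + F (pi + (c + pi))"
      if x: "x > 0" "x \<le> pi" for x
    proof (rule DERIV_nonneg_imp_nondecreasing[OF \<open>x \<le> pi\<close>])
      fix y assume y: "x \<le> y" "y \<le> pi"
      have s: "sin (y + c) = sin y" "sin (y + (c + pi)) = - sin y"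
        using c by (simp_all add: sin_add cos_add)
      have "sin y \<ge> 0" using x y by (intro sin_ge_zero) auto
      have "- (sin y ^ b / (y + c) ^ n) \<le> - (sin y ^ b / (y + (c + pi)) ^ n)"
        using x y \<open>c \<ge> 0\<close> \<open>sin y \<ge> 0\<close>
        by (auto intro!: divide_left_mono power_mono mult_pos_pos)
      \<comment> \<open>For odd \<open>b\<close> this is an equality; for even \<open>b\<close> the
        right side is nonnegative.\<close>
      also have "\<dots> \<le> (- sin y) ^ b / (y + (c + pi)) ^ n"
        using x y \<open>c \<ge> 0\<close> \<open>sin y \<ge> 0\<close> by (cases "even b") (auto simp: divide_nonneg_pos)
      finally have "sin (y + c) ^ b / (y + c) ^ n + sin (y + (c + pi)) ^ b / (y + (c + pi)) ^ n \<ge> 0"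
        unfolding s by linarith
      moreover have "((\<lambda>x. F (x + c) + F (x + (c + pi))) has_real_derivative
          sin (y + c) ^ b / (y + c) ^ n + sin (y + (c + pi)) ^ b / (y + (c + pi)) ^ n) (at y)"
        using x y \<open>c \<ge> 0\<close> by (intro DERIV_add shift) auto
      ultimately show "\<exists>z. ((\<lambda>x. F (x + c) + F (x + (c + pi))) has_real_derivative z) (at y) \<and> 0 \<le> z"
        by blast
    qed
    have "isCont (\<lambda>x. F (x + (c + pi))) 0"
      by (rule DERIV_isCont[OF shift]) (use \<open>c \<ge> 0\<close> in \<open>simp add: add_nonneg_pos\<close>)
    then have "((\<lambda>x. F (x + (c + pi))) \<longlongrightarrow> F (0 + (c + pi))) (at_right 0)"
      unfolding isCont_def by (rule tendsto_within_subset) simp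
    from tendsto_add[OF lim this]
    \<comment> \<open>Letting x tend to 0 in \<open>mono\<close> leaves \<open>F (c + pi)\<close> on
      both sides, where it cancels.\<close>
    have "p + F (0 + (c + pi)) \<le> F (pi + c) + F (pi + (c + pi))"
    proof (rule tendsto_upperbound)
      show "\<forall>\<^sub>F x in at_right 0. F (x + c) + F (x + (c + pi)) \<le> F (pi + c) + F (pi + (c + pi))"
        by (rule eventually_at_rightI[of 0 pi], intro mono) auto
    qed simp
    then show ?thesis by (simp add: algebra_simps)
  qed
  have "l \<le> F (2 * real (Suc m) * pi)" for m
  proof (induction m)
    case 0
    then show ?case using period[of 0 l 0] F(2) by simp
  next
    case (Suc m)
    let ?c = "2 * real (Suc m) * pi"
    have "isCont (\<lambda>x. F (x + ?c)) 0"
      by (rule DERIV_isCont[OF shift]) simp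
    then have "((\<lambda>x. F (x + ?c)) \<longlongrightarrow> F (0 + ?c)) (at_right 0)"
      unfolding isCont_def by (rule tendsto_within_subset) simp
    from period[OF this refl] Suc show ?case by (simp add: algebra_simps)
  qed
  moreover have "(\<lambda>m. F (2 * real (Suc m) * pi)) \<longlonglongrightarrow> u"
  proof (rule filterlim_compose[OF F(3)])
    show "filterlim (\<lambda>m. 2 * real (Suc m) * pi) at_top sequentially"
      by real_asymp
  qed
  ultimately have "l \<le> u"
    by (intro LIMSEQ_le_const) auto
  then show ?thesis by (simp add: F(4))
qed

section \<open>Divergence at 0 when \<open>b \<le> a\<close>\<close>

text \<open>On the unit interval \<open>cos y = 1 - 2 * (sin (y / 2))\<^sup>2 \<ge> 1 / 2\<close>,
  so \<open>sin x - x / 2\<close> is nondecreasing.\<close>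

lemma sin_ge_half:
  assumes "0 \<le> x" and "x \<le> (1::real)"
  shows "x / 2 \<le> sin x"
proof -
  have "sin 0 - 0 / 2 \<le> sin x - x / 2"
  proof (rule DERIV_nonneg_imp_nondecreasing[OF \<open>0 \<le> x\<close>, where f = "\<lambda>x. sin x - x / 2"])
    fix y assume y: "0 \<le> y" "y \<le> x"
    have "(sin (y / 2))\<^sup>2 \<le> (1 / 2)\<^sup>2"
      using abs_sin_x_le_abs_x[of "y / 2"] y assms by (intro power2_le_iff_abs_le[THEN iffD2]) auto
    then have "cos y - 1 / 2 \<ge> 0"
      using cos_double_sin[of "y / 2"] by (simp add: power2_eq_square)
    moreover have "((\<lambda>x. sin x - x / 2) has_real_derivative cos y - 1 / 2) (at y)"
      by (auto intro!: derivative_eq_intros)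
    ultimately show "\<exists>z. ((\<lambda>x. sin x - x / 2) has_real_derivative z) (at y) \<and> 0 \<le> z"
      by blast
  qed
  then show ?thesis by simp
qed

text \<open>On \<open>{e..1}\<close> the numerator is at least
  \<open>(x / 2) ^ b \<ge> x ^ a / 2 ^ b\<close>, so the integral is at least
  \<open>- ln e / 2 ^ b\<close>, which is unbounded as \<open>e\<close> tends to 0.\<close>

lemma sin_power_improper_integral_diverges:
  assumes "b \<le> a"
  shows "\<not> improper_integral_converges (\<lambda>x. sin x ^ b / x ^ (a + 1))"
proof
  let ?f = "\<lambda>x::real. sin x ^ b / x ^ (a + 1)"
  assume "improper_integral_converges ?f"
  then obtain l where int: "\<And>e. 0 < e \<Longrightarrow> e < 1 \<Longrightarrow> ?f integrable_on {e..1}"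
    and lim: "((\<lambda>e. integral {e..1} ?f) \<longlongrightarrow> l) (at_right 0)"
    unfolding improper_integral_converges_def by blast
  have "- ln e / 2 ^ b \<le> integral {e..1} ?f" if e: "0 < e" "e < 1" for e
  proof -
    have "((\<lambda>x. 1 / x / 2 ^ b) has_integral (ln 1 / 2 ^ b - ln e / 2 ^ b)) {e..1}"
      by (rule fundamental_theorem_of_calculus)
        (use e in \<open>auto intro!: derivative_eq_intros
          simp: has_real_derivative_iff_has_vector_derivative[symmetric]\<close>)
    moreover have "(?f has_integral integral {e..1} ?f) {e..1}"
      using int[OF e] by (rule integrable_integral)
    moreover have "1 / x / 2 ^ b \<le> ?f x" if "x \<in> {e..1}" for x
    proof -
      have x: "0 < x" "x \<le> 1" using that e by auto
      have "x ^ a / 2 ^ b \<le> x ^ b / 2 ^ b"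
        using x assms by (intro divide_right_mono power_decreasing) auto
      also have "\<dots> = (x / 2) ^ b"
        by (simp add: power_divide)
      also have "\<dots> \<le> sin x ^ b"
        using x by (intro power_mono sin_ge_half) auto
      finally have "x ^ a / 2 ^ b / x ^ (a + 1) \<le> ?f x"
        using x by (intro divide_right_mono) auto
      then show ?thesis using x by (simp add: field_simps)
    qed
    ultimately have "ln 1 / 2 ^ b - ln e / 2 ^ b \<le> integral {e..1} ?f"
      by (rule has_integral_le)
    then show ?thesis by simp
  qed
  then have "\<forall>\<^sub>F e in at_right 0. - ln e / 2 ^ b \<le> integral {e..1} ?f"
    by (intro eventually_at_rightI[of 0 1]) auto
  moreover have "filterlim (\<lambda>e::real. - ln e / 2 ^ b) at_top (at_right 0)"
    by real_asymp
  ultimately have "filterlim (\<lambda>e. integral {e..1} ?f) at_top (at_right 0)"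
    by (rule filterlim_at_top_mono[rotated])
  then have "filterlim (\<lambda>e. integral {e..1} ?f) at_infinity (at_right 0)"
    by (rule filterlim_at_top_imp_at_infinity)
  with lim show False
    using not_tendsto_and_filterlim_at_infinity trivial_limit_at_right_real by blast
qed

section \<open>Folding the frequency sum\<close>

lemma sin_half_pi_eq_0_or:
  "even n \<and> sin (real n * pi / 2) = 0 \<or> odd n \<and> cos (real n * pi / 2) = 0"
proof (cases "even n")
  case True
  then obtain k where "n = 2 * k" by blast
  with True show ?thesis by simp
next
  case False
  then obtain k where k: "n = 2 * k + 1" by (blast elim: oddE)
  have "cos (real n * pi / 2) = cos (real k * pi + pi / 2)"
    by (simp add: k algebra_simps add_divide_distrib)
  then show ?thesis using False by (simp add: cos_add)
qed

text \<open>The reflection of \<open>i\<close> to \<open>b - i\<close> negates the frequency and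
  preserves the term, so the indices with \<open>2 * i < b\<close> count twice and are renamed to
  \<open>k = b - 2 * i\<close>. The zero frequency drops out because \<open>a > 0\<close>.\<close>

lemma fold_frequency_sum:
  fixes a b :: nat
  defines "s \<equiv> real (a + b) * pi / 2"
  assumes "a > 0"
  shows "(\<Sum>i\<le>b. real (b choose i) * (-1) ^ i * (real b - 2 * real i) ^ a *
        (pi / 2 * sgn (real b - 2 * real i) * sin s - ln \<bar>real b - 2 * real i\<bar> * cos s)) =
     2 * (-1) ^ (b div 2) *
     (\<Sum>k = 1..b. real k ^ a * t_coeff b k * real (b choose ((b - k) div 2)) * d_coeff a b k)"
    (is "sum ?T _ = 2 * _ * sum ?S _")
proof -
  have sym: "?T (b - i) = ?T i" if "i \<le> b" for i
  proof -
    have w: "real b - 2 * real (b - i) = - (real b - 2 * real i)"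
      using that by (simp add: of_nat_diff)
    have m: "(-1) ^ (b - i) = (-1) ^ b * ((-1) ^ i :: real)"
      using that by (simp add: minus_one_power_iff)
    have p: "(- (real b - 2 * real i)) ^ a = (-1) ^ a * (real b - 2 * real i) ^ a"
      by (rule power_minus)
    \<comment> \<open>Moves the signs \<open>(-1) ^ b\<close> and \<open>(-1) ^ a\<close> next to
      the bracket. For even \<open>a + b\<close> they cancel and only the logarithm, even in the
      frequency, survives; for odd \<open>a + b\<close> only \<open>sgn\<close> survives, and its
      oddness absorbs the sign.\<close>
    have rearr: "C * (x * e) * (y * W) * D = C * e * W * (y * x * D)" for C x e y W D :: real
      by (simp add: mult_ac)
    have "(-1) ^ a * (-1) ^ b * (pi / 2 * - sgn (real b - 2 * real i) * sin s
          - ln \<bar>real b - 2 * real i\<bar> * cos s) =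
        pi / 2 * sgn (real b - 2 * real i) * sin s - ln \<bar>real b - 2 * real i\<bar> * cos s"
      using sin_half_pi_eq_0_or[of "a + b"] unfolding s_def power_add[symmetric] by auto
    then show ?thesis
      unfolding w m p binomial_symmetric[OF that, symmetric] abs_minus_cancel sgn_minus rearr
      by (simp only:)
  qed
  have zero: "?T i = 0" if "2 * i = b" for i
    using that \<open>a > 0\<close> by auto
  have "sum ?T {..b} = sum ?T {i. 2 * i < b} + sum ?T {i. 2 * i = b} + sum ?T {i. b < 2 * i \<and> i \<le> b}"
  proof -
    have fin: "finite {i. 2 * i < b}" "finite {i. 2 * i = b}" "finite {i. b < 2 * i \<and> i \<le> b}"
      by (auto intro: finite_subset[of _ "{..b}"])
    have "{..b} = ({i. 2 * i < b} \<union> {i. 2 * i = b}) \<union> {i. b < 2 * i \<and> i \<le> b}" by auto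
    moreover have "sum ?T (({i. 2 * i < b} \<union> {i. 2 * i = b}) \<union> {i. b < 2 * i \<and> i \<le> b}) =
        sum ?T ({i. 2 * i < b} \<union> {i. 2 * i = b}) + sum ?T {i. b < 2 * i \<and> i \<le> b}"
      using fin by (intro sum.union_disjoint) auto
    moreover have "sum ?T ({i. 2 * i < b} \<union> {i. 2 * i = b}) = sum ?T {i. 2 * i < b} + sum ?T {i. 2 * i = b}"
      using fin by (intro sum.union_disjoint) auto
    ultimately show ?thesis by (simp only:)
  qed
  also have "sum ?T {i. 2 * i = b} = 0"
    using zero by (intro sum.neutral) blast
  also have "sum ?T {i. b < 2 * i \<and> i \<le> b} = sum ?T {i. 2 * i < b}"
  proof (rule sum.reindex_bij_witness[of _ "\<lambda>i. b - i" "\<lambda>i. b - i"])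
    show "?T (b - i) = ?T i" if "i \<in> {i. b < 2 * i \<and> i \<le> b}" for i
      using that by (intro sym) simp
  qed auto
  finally have "sum ?T {..b} = 2 * sum ?T {i. 2 * i < b}" by simp
  also have "sum ?T {i. 2 * i < b} = (\<Sum>k\<in>{k\<in>{1..b}. even (b - k)}. (-1) ^ (b div 2) * ?S k)"
  proof (rule sum.reindex_bij_witness[of _ "\<lambda>k. (b - k) div 2" "\<lambda>i. b - 2 * i"])
    fix i assume "i \<in> {i. 2 * i < b}"
    then have i: "2 * i < b" by simp
    define k where "k = b - 2 * i"
    have k: "real b - 2 * real i = real k" "(b - k) div 2 = i" "even (b - k)" "k > 0"
      using i by (auto simp: k_def of_nat_diff)
    \<comment> \<open>Since \<open>b = k + 2 * i\<close>, the sign \<open>(-1) ^ i\<close> splits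
      into the sign of \<open>t_coeff\<close> and a factor independent of \<open>k\<close>.\<close>
    have "b div 2 = k div 2 + i" using i by (simp add: k_def)
    then have "(-1) ^ (b div 2) * t_coeff b k = ((-1) ^ (k div 2) * (-1) ^ (k div 2)) * (-1) ^ i"
      using k by (simp add: t_coeff_def power_add)
    then have "(-1) ^ (b div 2) * t_coeff b k = (-1) ^ i" by simp
    moreover have "(-1) ^ (b div 2) * ?S k =
        real (b choose i) * ((-1) ^ (b div 2) * t_coeff b k) * real k ^ a * d_coeff a b k"
      unfolding k(2) by (simp add: mult_ac)
    moreover have "d_coeff a b k = pi / 2 * sgn (real k) * sin s - ln \<bar>real k\<bar> * cos s"
      using k(4) by (simp add: d_coeff_expand s_def)
    ultimately have "(-1) ^ (b div 2) * ?S k = ?T i"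
      unfolding k(1) by (simp only:)
    then show "(-1) ^ (b div 2) * ?S (b - 2 * i) = ?T i"
      by (simp add: k_def)
  qed (auto elim!: evenE)
  \<comment> \<open>The indices with odd \<open>b - k\<close> may be put back, as their coefficient
    is 0.\<close>
  also have "\<dots> = (\<Sum>k = 1..b. (-1) ^ (b div 2) * ?S k)"
    by (rule sum.mono_neutral_left) (auto simp: t_coeff_odd)
  finally show ?thesis by (simp add: sum_distrib_left mult.assoc)
qed

section \<open>Evaluation of the integral\<close>

theorem proposition1:
  fixes a b :: nat
  assumes "a > 0" and "b > 0"
    and "improper_integral_converges (\<lambda>x. sin x ^ b / x ^ (a + 1))"
  shows "improper_integral (\<lambda>x. sin x ^ b / x ^ (a + 1)) =
    \<bar>\<Sum>k = 1..b. real k ^ a * t_coeff b k * real (b choose ((b - k) div 2)) * d_coeff a b k\<bar>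
      / (2 ^ (b - 1) * Gamma (real a + 1))"
proof -
  have "a < b"
    using assms(3) sin_power_improper_integral_diverges by (meson not_le)
  define w where "w i = real b - 2 * real i" for i
  define c where "c i = real (b choose i) * (-1) ^ i" for i
  \<comment> \<open>The \<open>j\<close>-th derivative of the expansion: each differentiation
    contributes a factor \<open>w i\<close> and advances the phase by \<open>pi / 2\<close>.\<close>
  define g where "g j x = (\<Sum>i\<le>b. c i * w i ^ j / 2 ^ b *
      cos (w i * x + (real j - real b) * pi / 2))" for j x
  define \<phi> where "\<phi> = (real a - real b) * pi / 2"
  define s where "s = real (a + b) * pi / 2"
  have g_0: "g 0 = (\<lambda>x. sin x ^ b)"
    unfolding sin_power_expansion g_def c_def w_def
    by (simp add: sum_divide_distrib fun_eq_iff)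
  have g_deriv: "(g j has_real_derivative g (Suc j) x) (at x)" for j x
  proof -
    have "cos (y + (1 + real j - real b) * pi / 2) = - sin (y + (real j - real b) * pi / 2)" for y
    proof -
      have "y + (1 + real j - real b) * pi / 2 = (y + (real j - real b) * pi / 2) + pi / 2"
        by (simp add: field_simps)
      then show ?thesis by (simp only: cos_add) simp
    qed
    then have "g (Suc j) x = (\<Sum>i\<le>b. c i * w i ^ j / 2 ^ b *
        (- sin (w i * x + (real j - real b) * pi / 2) * w i))"
      unfolding g_def by (intro sum.cong refl) simp
    moreover have "(g j has_real_derivative (\<Sum>i\<le>b. c i * w i ^ j / 2 ^ b *
        (- sin (w i * x + (real j - real b) * pi / 2) * w i))) (at x)"
      unfolding g_def
      by (intro DERIV_sum DERIV_cmult) (auto intro!: derivative_eq_intros)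
    ultimately show ?thesis by simp
  qed
  have van: "trig_vanishing b (g 0)"
    using trig_vanishing.base[of b b 0] by (simp add: g_0)
  have "trig_vanishing (b - a) (g a)"
    by (rule trig_vanishing_iterated_deriv[OF g_deriv van]) (use \<open>a < b\<close> in simp)
  then have g_a: "g a 0 = 0"
    using \<open>a < b\<close> by (intro trig_vanishing_zero[of "b - a - 1"]) (simp add: Suc_diff_Suc)
  \<comment> \<open>The two side conditions hold because \<open>g a 0 = 0\<close> is exactly the
    vanishing of the cosine weights, and \<open>a > 0\<close> makes \<open>w i ^ a\<close> vanish at
    the zero frequency.\<close>
  have "has_improper_integral (\<lambda>x. (\<Sum>i\<le>b. c i * w i ^ a / 2 ^ b * cos (w i * x + \<phi>)) / x)
      (- (\<Sum>i\<le>b. c i * w i ^ a / 2 ^ b * (pi / 2 * sgn (w i) * sin \<phi> + ln \<bar>w i\<bar> * cos \<phi>)))"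
  proof (rule has_improper_integral_cos_sum)
    show "(\<Sum>i\<le>b. c i * w i ^ a / 2 ^ b * cos \<phi>) = 0"
      using g_a unfolding g_def \<phi>_def by simp
  qed (use \<open>a > 0\<close> in auto)
  then have "has_improper_integral (\<lambda>x. g (0 + a) x / x)
      (- (\<Sum>i\<le>b. c i * w i ^ a / 2 ^ b * (pi / 2 * sgn (w i) * sin \<phi> + ln \<bar>w i\<bar> * cos \<phi>)))"
    by (simp add: g_def \<phi>_def)
  from has_improper_integral_iterated_parts[OF g_deriv van \<open>a < b\<close> this]
  obtain v where v: "v = - (\<Sum>i\<le>b. c i * w i ^ a / 2 ^ b *
      (pi / 2 * sgn (w i) * sin \<phi> + ln \<bar>w i\<bar> * cos \<phi>)) / fact a"
    and int: "has_improper_integral (\<lambda>x. sin x ^ b / x ^ (a + 1)) v"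
    by (simp add: g_0)
  define P where "P = (\<Sum>i\<le>b. c i * w i ^ a * (pi / 2 * sgn (w i)))"
  define Q where "Q = (\<Sum>i\<le>b. c i * w i ^ a * ln \<bar>w i\<bar>)"
  \<comment> \<open>The phases \<open>\<phi>\<close> and \<open>s\<close> differ by a multiple of
    \<open>pi\<close>, hence only by the global sign \<open>(-1) ^ b\<close>.\<close>
  have \<phi>: "\<phi> = s - real b * pi"
    by (simp add: \<phi>_def s_def field_simps)
  have sc: "sin \<phi> = (-1) ^ b * sin s" "cos \<phi> = (-1) ^ b * cos s"
    by (simp_all add: \<phi> sin_diff cos_diff)
  have "(\<Sum>i\<le>b. c i * w i ^ a / 2 ^ b * (pi / 2 * sgn (w i) * sin \<phi> + ln \<bar>w i\<bar> * cos \<phi>)) =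
      (\<Sum>i\<le>b. (-1) ^ b / 2 ^ b * (c i * w i ^ a * (pi / 2 * sgn (w i)) * sin s + c i * w i ^ a * ln \<bar>w i\<bar> * cos s))"
    unfolding sc by (intro sum.cong refl) (simp add: field_simps)
  also have "\<dots> = (-1) ^ b / 2 ^ b * (P * sin s + Q * cos s)"
    unfolding P_def Q_def sum_distrib_left[symmetric] sum.distrib sum_distrib_right ..
  finally have "v = - ((-1) ^ b * (P * sin s + Q * cos s)) / (2 ^ b * fact a)"
    by (simp add: v)
  then have "\<bar>v\<bar> = \<bar>P * sin s + Q * cos s\<bar> / (2 ^ b * fact a)"
    by (simp add: abs_mult power_abs)
  \<comment> \<open>One of \<open>sin s\<close> and \<open>cos s\<close> is 0, so the relative sign
    is invisible under the absolute value.\<close>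
  also have "\<bar>P * sin s + Q * cos s\<bar> = \<bar>P * sin s - Q * cos s\<bar>"
    using sin_half_pi_eq_0_or[of "a + b"] by (auto simp: s_def)
  also have "P * sin s - Q * cos s = (\<Sum>i\<le>b. c i * w i ^ a *
      (pi / 2 * sgn (w i) * sin s - ln \<bar>w i\<bar> * cos s))"
    unfolding P_def Q_def sum_distrib_right sum_subtractf[symmetric]
    by (intro sum.cong refl) (simp add: right_diff_distrib)
  also have "\<dots> = 2 * (-1) ^ (b div 2) *
     (\<Sum>k = 1..b. real k ^ a * t_coeff b k * real (b choose ((b - k) div 2)) * d_coeff a b k)"
    unfolding c_def w_def s_def by (rule fold_frequency_sum[OF \<open>a > 0\<close>])
  finally have "\<bar>v\<bar> = \<bar>\<Sum>k = 1..b. real k ^ a * t_coeff b k * real (b choose ((b - k) div 2)) * d_coeff a b k\<bar>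
      * 2 / (2 ^ b * fact a)"
    by (simp add: abs_mult power_abs)
  \<comment> \<open>The factor 2 from folding lowers the exponent to \<open>b - 1\<close>.\<close>
  also have "(2::real) ^ b = 2 * 2 ^ (b - 1)"
    using \<open>b > 0\<close> by (cases b) auto
  finally have "\<bar>v\<bar> = \<bar>\<Sum>k = 1..b. real k ^ a * t_coeff b k * real (b choose ((b - k) div 2)) * d_coeff a b k\<bar>
      / (2 ^ (b - 1) * Gamma (real a + 1))"
    using Gamma_fact[of a, where 'a = real] by (simp add: add.commute)
  then show ?thesis
    using has_improper_integral_imp_eq[OF int] has_improper_integral_sin_power_nonneg[OF int] by simp
qed

end
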